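(* If $G$ is a connected graph and $C$ is a minimum edge cut of $G$, then $$\gamma_g(G) \le \gamma_g(G\setminus C) + 2\kappa'(G).$$
   Context: Graphs are finite and simple. A vertex $x$ dominates every vertex of its closed neighborhood $N[x]$ ($x$ together with its neighbors). The domination game on a graph $G$ is played by Dominator and Staller, who take turns choosing a vertex of $G$ such that at least one previously undominated vertex becomes dominated. The game is over when all vertices of $G$ are dominated. Dominator wants to minimize the number of vertices played, Staller wants to maximize it. In the D-game Dominator has the first move, and $\gamma_g(G)$ (the game domination number) is the number of moves played in the D-game when both players play optimally. The graph $G$ need not be connected. An edge cut of a connected graph $G$ is a set $C$ of edges such that $G\setminus C$ is disconnected, where $G\setminus C$ denotes the graph obtained from $G$ by deleting the edges in $C$ (keeping all vertices). A minimum edge cut is an edge cut of smallest cardinality, and this cardinality is the edge-connectivity $\kappa'(G)$. *)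

theory Defs
  imports Main
begin

record 'a ugraph =
  verts :: "'a set"
  edges :: "'a set set"

definition simple_graph :: "'a ugraph \<Rightarrow> bool" where
  "simple_graph G \<longleftrightarrow>
     finite (verts G) \<and> (\<forall>e \<in> edges G. e \<subseteq> verts G \<and> card e = 2)"

definition adj_rel :: "'a ugraph \<Rightarrow> ('a \<times> 'a) set" where
  "adj_rel G = {(u, v). {u, v} \<in> edges G}"

(* The graph without vertices is not connected. *)
definition connected_graph :: "'a ugraph \<Rightarrow> bool" where
  "connected_graph G \<longleftrightarrow>
     verts G \<noteq> {} \<and> (\<forall>u \<in> verts G. \<forall>v \<in> verts G. (u, v) \<in> (adj_rel G)\<^sup>*)"

definition delete_edges :: "'a ugraph \<Rightarrow> 'a set set \<Rightarrow> 'a ugraph" where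
  "delete_edges G C = \<lparr>verts = verts G, edges = edges G - C\<rparr>"

definition edge_cut :: "'a ugraph \<Rightarrow> 'a set set \<Rightarrow> bool" where
  "edge_cut G C \<longleftrightarrow> C \<subseteq> edges G \<and> \<not> connected_graph (delete_edges G C)"

definition minimum_edge_cut :: "'a ugraph \<Rightarrow> 'a set set \<Rightarrow> bool" where
  "minimum_edge_cut G C \<longleftrightarrow>
     edge_cut G C \<and> (\<forall>C'. edge_cut G C' \<longrightarrow> card C \<le> card C')"

(* Only meaningful for graphs that have an edge cut,
   that is, for connected graphs with at least two vertices. *)
definition edge_connectivity :: "'a ugraph \<Rightarrow> nat" where
  "edge_connectivity G = (LEAST k. \<exists>C. edge_cut G C \<and> card C = k)"

definition closed_nbhd :: "'a ugraph \<Rightarrow> 'a \<Rightarrow> 'a set" where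
  "closed_nbhd G v = insert v {u \<in> verts G. {u, v} \<in> edges G}"

definition dominated :: "'a ugraph \<Rightarrow> 'a set \<Rightarrow> 'a set" where
  "dominated G X = (\<Union>v \<in> X. closed_nbhd G v)"

definition legal_moves :: "'a ugraph \<Rightarrow> 'a set \<Rightarrow> 'a set" where
  "legal_moves G X = {v \<in> verts G. \<not> closed_nbhd G v \<subseteq> dominated G X}"

lemma legal_move_decreases:
  assumes "finite (verts G)" and "v \<in> legal_moves G X"
  shows "card (verts G - dominated G (insert v X)) < card (verts G - dominated G X)"
proof (rule psubset_card_mono)
  show "finite (verts G - dominated G X)"
    using assms(1) by simp
  show "verts G - dominated G (insert v X) \<subset> verts G - dominated G X"
    using assms(2) by (auto simp: legal_moves_def dominated_def closed_nbhd_def)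
qed

datatype player = Dominator | Staller

(* The number of moves still to be played under optimal play, when X is the set
   of vertices chosen so far and the given player is to move.  The recursion is
   well-founded only on finite vertex sets; otherwise the value is 0 by convention. *)
function game_length :: "'a ugraph \<Rightarrow> player \<Rightarrow> 'a set \<Rightarrow> nat" where
  "game_length G Dominator X =
     (if finite (verts G) \<and> \<not> verts G \<subseteq> dominated G X
      then 1 + Min ((\<lambda>v. game_length G Staller (insert v X)) ` legal_moves G X)
      else 0)"
| "game_length G Staller X =
     (if finite (verts G) \<and> \<not> verts G \<subseteq> dominated G X
      then 1 + Max ((\<lambda>v. game_length G Dominator (insert v X)) ` legal_moves G X)
      else 0)"
  by pat_completeness auto
termination
  by (relation "measure (\<lambda>(G, p, X). card (verts G - dominated G X))")
    (auto intro: legal_move_decreases)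

declare game_length.simps [simp del]

definition game_domination_number :: "'a ugraph \<Rightarrow> nat" where
  "game_domination_number G = game_length G Dominator {}"

end

(* It suffices to treat the deletion of a single edge uv. Let Dominator open the game on G
   with u. From then on u and v are both dominated, so the edge uv plays no role any more, and
   by the continuation principle the rest of the game is at most as long as the Staller-start
   game on G - uv, which in turn exceeds the Dominator-start game by at most one move. *)
theory Submission
  imports Defs
begin

lemma dominated_insert: "dominated G (insert v X) = closed_nbhd G v \<union> dominated G X"
  by (simp add: dominated_def)

text \<open>An undominated vertex lies in its own closed neighbourhood, so playing it is legal.
  Hence every \<open>Min\<close> and \<open>Max\<close> in an unfinished game ranges over a nonempty
  set.\<close>

lemma legal_moves_nonempty:
  assumes "\<not> verts G \<subseteq> dominated G X"
  shows "legal_moves G X \<noteq> {}"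
  using assms by (auto simp: legal_moves_def closed_nbhd_def)

lemma finite_legal_moves: "finite (verts G) \<Longrightarrow> finite (legal_moves G X)"
  by (simp add: legal_moves_def)

lemma game_length_Dominator_le:
  assumes "finite (verts G)" and "v \<in> legal_moves G X"
  shows "game_length G Dominator X \<le> 1 + game_length G Staller (insert v X)"
  using assms by (simp add: game_length.simps(1) finite_legal_moves)

lemma game_length_Dominator_attained:
  assumes "finite (verts G)" and "\<not> verts G \<subseteq> dominated G X"
  obtains v where "v \<in> legal_moves G X"
    and "game_length G Dominator X = 1 + game_length G Staller (insert v X)"
proof -
  have "Min ((\<lambda>v. game_length G Staller (insert v X)) ` legal_moves G X)
      \<in> (\<lambda>v. game_length G Staller (insert v X)) ` legal_moves G X"
    using assms by (intro Min_in) (auto simp: finite_legal_moves legal_moves_nonempty)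
  then show thesis
    using assms that by (auto simp: game_length.simps(1))
qed

lemma game_length_Staller_ge:
  assumes "finite (verts G)" and "v \<in> legal_moves G X"
  shows "1 + game_length G Dominator (insert v X) \<le> game_length G Staller X"
proof -
  \<comment> \<open>A lower bound has to exclude the value 0 of a finished game. The vertex newly
    dominated by \<open>v\<close> lies in \<open>verts G\<close>, so the game is still
    running.\<close>
  have "\<not> verts G \<subseteq> dominated G X \<or> \<not> closed_nbhd G v \<subseteq> verts G"
    using assms(2) by (auto simp: legal_moves_def)
  moreover have "closed_nbhd G v \<subseteq> verts G"
    using assms(2) by (auto simp: legal_moves_def closed_nbhd_def)
  ultimately show ?thesis
    using assms by (simp add: game_length.simps(2) finite_legal_moves)
qed

lemma game_length_Staller_attained:
  assumes "finite (verts G)" and "\<not> verts G \<subseteq> dominated G X"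
  obtains v where "v \<in> legal_moves G X"
    and "game_length G Staller X = 1 + game_length G Dominator (insert v X)"
proof -
  have "Max ((\<lambda>v. game_length G Dominator (insert v X)) ` legal_moves G X)
      \<in> (\<lambda>v. game_length G Dominator (insert v X)) ` legal_moves G X"
    using assms by (intro Max_in) (auto simp: finite_legal_moves legal_moves_nonempty)
  then show thesis
    using assms that by (auto simp: game_length.simps(2))
qed

lemma game_length_finished:
  assumes "verts G \<subseteq> dominated G X"
  shows "game_length G p X = 0"
  using assms by (cases p) (simp_all add: game_length.simps)

text \<open>The continuation principle, for two graphs whose neighbourhoods differ only in vertices
  that are already dominated.\<close>

lemma game_length_continuation:
  assumes "finite (verts G)" and "verts H = verts G"
    and "dominated H Y \<subseteq> dominated G X"
    and "\<And>w. w \<in> verts G \<Longrightarrow>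
      closed_nbhd H w \<union> dominated G X = closed_nbhd G w \<union> dominated G X"
  shows "game_length G p X \<le> game_length H p Y"
  using assms(3,4)
proof (induction "card (verts G - dominated G X)" arbitrary: p X Y rule: less_induct)
  case less
  note sub = less.prems(1) and nbhd = less.prems(2)
  have finH: "finite (verts H)"
    using assms(1,2) by simp
  \<comment> \<open>One move in each game. The vertices may differ, since Dominator may have to
    replace \<open>w\<close> in G; \<open>vw\<close> keeps the position in G ahead: N_H[w] is
    covered by N_G[w] and \<open>dominated G X\<close>, hence by N_G[v] and
    \<open>dominated G X\<close>. The neighbourhood hypothesis persists because dominated sets only
    grow.\<close>
  have step: "game_length G q (insert v X) \<le> game_length H q (insert w Y)"
    if v: "v \<in> legal_moves G X" and w: "w \<in> verts G"
      and vw: "closed_nbhd G w \<subseteq> closed_nbhd G v \<union> dominated G X" for q v w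
  proof (rule less.hyps)
    show "card (verts G - dominated G (insert v X)) < card (verts G - dominated G X)"
      using assms(1) v by (rule legal_move_decreases)
    show "dominated H (insert w Y) \<subseteq> dominated G (insert v X)"
      using sub nbhd[OF w] vw unfolding dominated_insert by blast
    show "closed_nbhd H x \<union> dominated G (insert v X) = closed_nbhd G x \<union> dominated G (insert v X)"
      if "x \<in> verts G" for x
      using nbhd[OF that] unfolding dominated_insert by blast
  qed
  show ?case
  proof (cases "verts G \<subseteq> dominated G X")
    case True
    then show ?thesis by (simp add: game_length_finished)
  next
    case False
    then have notH: "\<not> verts H \<subseteq> dominated H Y"
      using sub assms(2) by auto
    show ?thesis
    proof (cases p)
      case Dominator
      obtain w where w: "w \<in> legal_moves H Y"
        and eq: "game_length H Dominator Y = 1 + game_length H Staller (insert w Y)"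
        using game_length_Dominator_attained[OF finH notH] .
      have wG: "w \<in> verts G"
        using w assms(2) by (simp add: legal_moves_def)
      \<comment> \<open>If Dominator's optimal reply in the game on H is not legal in G, any legal move is as good.\<close>
      obtain v where v: "v \<in> legal_moves G X"
        and vw: "closed_nbhd G w \<subseteq> closed_nbhd G v \<union> dominated G X"
      proof (cases "w \<in> legal_moves G X")
        case True
        then show ?thesis using that by blast
      next
        case notlegal: False
        then have "closed_nbhd G w \<subseteq> dominated G X"
          using wG by (simp add: legal_moves_def)
        then show ?thesis
          using that legal_moves_nonempty[OF False] by blast
      qed
      have "game_length G Dominator X \<le> 1 + game_length G Staller (insert v X)"
        using assms(1) v by (rule game_length_Dominator_le)
      then show ?thesis
        using step[OF v wG vw, of Staller] eq Dominator by simp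
    next
      case Staller
      \<comment> \<open>The imitation now runs the other way: Staller's optimal move in G is copied
        to H.\<close>
      obtain v where v: "v \<in> legal_moves G X"
        and eq: "game_length G Staller X = 1 + game_length G Dominator (insert v X)"
        using game_length_Staller_attained[OF assms(1) False] .
      have vG: "v \<in> verts G"
        using v by (simp add: legal_moves_def)
      \<comment> \<open>A vertex newly dominated by \<open>v\<close> in G lies outside
        \<open>dominated G X\<close>. By \<open>nbhd\<close> it is also in N_H[v], and by
        \<open>sub\<close> it is undominated in H.\<close>
      have "v \<in> legal_moves H Y"
        using v sub nbhd[OF vG] assms(2) unfolding legal_moves_def by blast
      with finH have "1 + game_length H Dominator (insert v Y) \<le> game_length H Staller Y"
        by (rule game_length_Staller_ge)
      then show ?thesis
        using step[OF v vG, of Dominator] eq Staller by simp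
    qed
  qed
qed

text \<open>After Staller's first move Dominator is to move with at least as much dominated as
  before, so the continuation principle with H = G bounds what remains.\<close>

lemma game_length_Staller_le_Dominator:
  assumes "finite (verts G)"
  shows "game_length G Staller X \<le> 1 + game_length G Dominator X"
proof (cases "verts G \<subseteq> dominated G X")
  case True
  then show ?thesis by (simp add: game_length_finished)
next
  case False
  obtain v where "game_length G Staller X = 1 + game_length G Dominator (insert v X)"
    using game_length_Staller_attained[OF assms False] .
  moreover have "game_length G Dominator (insert v X) \<le> game_length G Dominator X"
    by (rule game_length_continuation) (auto simp: assms dominated_insert)
  ultimately show ?thesis by simp
qed

lemma simple_graph_delete_edges: "simple_graph G \<Longrightarrow> simple_graph (delete_edges G C)"
  by (simp add: simple_graph_def delete_edges_def)

lemma game_domination_number_delete_edge: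
  assumes "simple_graph G"
  shows "game_domination_number G \<le> game_domination_number (delete_edges G {e}) + 2"
proof (cases "e \<in> edges G")
  \<comment> \<open>Allowing a non-edge \<open>e\<close> lets the later induction run over an
    arbitrary finite set \<open>C\<close>.\<close>
  case False
  then have "delete_edges G {e} = G"
    by (simp add: delete_edges_def)
  then show ?thesis by simp
next
  case True
  let ?H = "delete_edges G {e}"
  have fin: "finite (verts G)" and e: "e \<subseteq> verts G" "card e = 2"
    using assms True by (auto simp: simple_graph_def)
  obtain u v where uv: "e = {u, v}"
    using e(2) by (auto simp: card_2_iff)
  have "u \<in> legal_moves G {}"
    using e(1) uv by (simp add: legal_moves_def dominated_def closed_nbhd_def)
  with fin have "game_length G Dominator {} \<le> 1 + game_length G Staller {u}"
    by (rule game_length_Dominator_le)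
  also have "game_length G Staller {u} \<le> game_length ?H Staller {}"
  proof (rule game_length_continuation[OF fin])
    show "verts ?H = verts G"
      by (simp add: delete_edges_def)
    show "dominated ?H {} \<subseteq> dominated G {u}"
      by (simp add: dominated_def)
    \<comment> \<open>Deleting \<open>e\<close> only removes \<open>v\<close> from N[u] and
      \<open>u\<close> from N[v], and \<open>u\<close> dominates both vertices in G.\<close>
    have "e \<subseteq> dominated G {u}"
      using e(1) True uv by (auto simp: dominated_def closed_nbhd_def insert_commute)
    then show "closed_nbhd ?H w \<union> dominated G {u} = closed_nbhd G w \<union> dominated G {u}" for w
      by (auto simp: closed_nbhd_def delete_edges_def)
  qed
  also have "game_length ?H Staller {} \<le> 1 + game_length ?H Dominator {}"
    using fin by (intro game_length_Staller_le_Dominator) (simp add: delete_edges_def)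
  finally show ?thesis
    by (simp add: game_domination_number_def)
qed

lemma game_domination_number_delete_edges:
  assumes "finite C" and "simple_graph G"
  shows "game_domination_number G \<le> game_domination_number (delete_edges G C) + 2 * card C"
  using assms(1)
proof (induction C rule: finite_induct)
  case empty
  have "delete_edges G {} = G"
    by (simp add: delete_edges_def)
  then show ?case by simp
next
  case (insert e C)
  \<comment> \<open>The single-edge bound is applied to the graph from which \<open>C\<close> has
    already been removed.\<close>
  have "delete_edges G (insert e C) = delete_edges (delete_edges G C) {e}"
    by (auto simp: delete_edges_def)
  then have "game_domination_number (delete_edges G C)
      \<le> game_domination_number (delete_edges G (insert e C)) + 2"
    using game_domination_number_delete_edge[OF simple_graph_delete_edges[OF assms(2)]] by simp
  then show ?case
    using insert by simp
qed

lemma card_minimum_edge_cut: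
  assumes "minimum_edge_cut G C"
  shows "edge_connectivity G = card C"
  unfolding edge_connectivity_def
  using assms by (intro Least_equality) (auto simp: minimum_edge_cut_def)

theorem corollary3p2:
  fixes G :: "'a ugraph" and C :: "'a set set"
  assumes "simple_graph G"
    and "connected_graph G"
    and "minimum_edge_cut G C"
  shows "game_domination_number G
           \<le> game_domination_number (delete_edges G C) + 2 * edge_connectivity G"
proof -
  \<comment> \<open>The induction over the cut needs \<open>C\<close> finite; its members are
    subsets of a finite vertex set.\<close>
  have "C \<subseteq> Pow (verts G)" and "finite (verts G)"
    using assms(1,3) by (auto simp: simple_graph_def minimum_edge_cut_def edge_cut_def)
  then have "finite C"
    by (meson finite_Pow_iff finite_subset)
  then show ?thesis
    using game_domination_number_delete_edges assms(1) card_minimum_edge_cut[OF assms(3)] by metis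
qed

end
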